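(* There is an absolute constant $C \geq 1$ such that for all positive integers $m,n$ and every $m$-homogeneous polynomial $\sum_{|\alpha| = m} a_\alpha z^\alpha$ on $\mathbb{C}^n$ (with complex coefficients $a_\alpha$), $$\Big( \sum_{|\alpha| = m} |a_\alpha|^{\frac{2m}{m+1}} \Big)^{\frac{m+1}{2m}} \leq C^m \sup_{z \in \mathbb{D}^n} \Big|\sum_{|\alpha| = m} a_\alpha z^\alpha\Big| .$$
   Context: $\mathbb{D}$ is the open unit disc in $\mathbb{C}$. Sums over $|\alpha|=m$ run over all multi-indices $\alpha=(\alpha_1,\dots,\alpha_n)\in\mathbb{N}_0^n$ with $\alpha_1+\dots+\alpha_n=m$, and $z^\alpha = z_1^{\alpha_1}\cdots z_n^{\alpha_n}$. *)

theory Defs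
  imports "HOL-Analysis.Analysis"
begin

text \<open>
  The dimension \<open>n\<close> is quantified inside the scope of the constant, so it cannot be a type.
  For any set \<open>S\<close>, the power \<open>S\<^sup>n\<close> is rendered as the extensional function space
  \<open>{..<n} \<rightarrow>\<^sub>E S\<close>; coordinates are numbered from \<open>0\<close> to \<open>n - 1\<close>.
\<close>

definition multi_indices :: "nat \<Rightarrow> nat \<Rightarrow> (nat \<Rightarrow> nat) set" where
  "multi_indices n m = {\<alpha> \<in> {..<n} \<rightarrow>\<^sub>E (UNIV :: nat set). (\<Sum>i<n. \<alpha> i) = m}"

definition monomial_at :: "nat \<Rightarrow> (nat \<Rightarrow> nat) \<Rightarrow> (nat \<Rightarrow> complex) \<Rightarrow> complex" where
  "monomial_at n \<alpha> z = (\<Prod>i<n. z i ^ \<alpha> i)"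

text \<open>Only the values of \<open>a\<close> on \<open>multi_indices n m\<close> matter.\<close>

definition hom_poly ::
    "nat \<Rightarrow> nat \<Rightarrow> ((nat \<Rightarrow> nat) \<Rightarrow> complex) \<Rightarrow> (nat \<Rightarrow> complex) \<Rightarrow> complex" where
  "hom_poly n m a z = (\<Sum>\<alpha>\<in>multi_indices n m. a \<alpha> * monomial_at n \<alpha> z)"

definition polydisc :: "nat \<Rightarrow> (nat \<Rightarrow> complex) set" where
  "polydisc n = ({..<n} \<rightarrow>\<^sub>E ball 0 1)"

text \<open>
  Sums over infinite sets and suprema of unbounded or empty sets have default values in HOL;
  the following facts show that neither case arises.
\<close>

lemma finite_multi_indices: "finite (multi_indices n m)"
proof (rule finite_subset)
  show "multi_indices n m \<subseteq> {..<n} \<rightarrow>\<^sub>E {..m}"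
  proof
    fix \<alpha> assume \<alpha>: "\<alpha> \<in> multi_indices n m"
    have "\<alpha> i \<le> m" if "i < n" for i
      using \<alpha> that member_le_sum[of i "{..<n}" \<alpha>] by (auto simp: multi_indices_def)
    with \<alpha> show "\<alpha> \<in> {..<n} \<rightarrow>\<^sub>E {..m}"
      by (auto simp: multi_indices_def PiE_iff)
  qed
qed (simp add: finite_PiE)

lemma polydisc_nonempty: "polydisc n \<noteq> {}"
  by (auto simp: polydisc_def PiE_eq_empty_iff)

lemma bdd_above_hom_poly: "bdd_above ((\<lambda>z. cmod (hom_poly n m a z)) ` polydisc n)"
proof (rule bdd_aboveI2)
  fix z assume z: "z \<in> polydisc n"
  have "cmod (monomial_at n \<alpha> z) \<le> 1" for \<alpha>
    unfolding monomial_at_def prod_norm[symmetric] norm_power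
    using z by (intro prod_le_1 conjI power_le_one zero_le_power norm_ge_zero)
      (auto simp: polydisc_def PiE_iff less_imp_le)
  then have "cmod (a \<alpha> * monomial_at n \<alpha> z) \<le> cmod (a \<alpha>)" for \<alpha>
    by (simp add: norm_mult mult_left_le)
  then show "cmod (hom_poly n m a z) \<le> (\<Sum>\<alpha>\<in>multi_indices n m. cmod (a \<alpha>))"
    unfolding hom_poly_def by (intro sum_norm_le)
qed

end

theory Submission
  imports Defs "HOL-Complex_Analysis.Cauchy_Integral_Formula"
begin

text \<open>
  Put \<open>Q\<^sub>j = z\<^sub>j \<partial>P/\<partial>z\<^sub>j = \<Sum> \<alpha>\<^sub>j a\<^sub>\<alpha> z\<^sup>\<alpha>\<close>, \<open>A\<^sub>j = \<parallel>Q\<^sub>j\<parallel>\<^sub>2\<close> on the torus, \<open>S = \<Sum> A\<^sub>j\<close> and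
  \<open>p = 2m/(m+1)\<close>. Instead of Blei's inequality, Hoelder's inequality with the weight
  \<open>w(\<alpha>) = \<Prod> A\<^sub>j powr (\<alpha>\<^sub>j/m)\<close> gives \<open>\<Sum> |a\<^sub>\<alpha>|\<^sup>p \<le> S\<^sup>p\<close>: on the one hand
  \<open>\<Sum> w(\<alpha>)\<^sup>m \<le> S\<^sup>m\<close>, on the other \<open>1/w(\<alpha>) \<le> \<Sum> (\<alpha>\<^sub>j/m)/A\<^sub>j\<close> by the AM-GM inequality, so
  \<open>\<Sum> |a\<^sub>\<alpha>|\<^sup>2/w(\<alpha>) \<le> \<Sum> A\<^sub>j\<^sup>2/A\<^sub>j = S\<close>.

  It remains to bound \<open>S\<close>. A multi-index of order \<open>2m\<close> dominates at most \<open>4\<^sup>m\<close> multi-indices, whence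
  \<open>\<parallel>Q\<parallel>\<^sub>4\<^sup>4 = \<parallel>Q\<^sup>2\<parallel>\<^sub>2\<^sup>2 \<le> 4\<^sup>m \<parallel>Q\<parallel>\<^sub>2\<^sup>4\<close> for \<open>m\<close>-homogeneous \<open>Q\<close>, and by interpolation
  \<open>\<parallel>Q\<parallel>\<^sub>2 \<le> 2\<^sup>m \<parallel>Q\<parallel>\<^sub>1\<close>. Finally \<open>\<Sum> |Q\<^sub>j(z)| \<le> 3\<^sup>m sup |P|\<close> pointwise on the torus, by Cauchy's
  estimate. All averages over the torus are taken over a grid of roots of unity.
\<close>

section \<open>Orthogonality of monomials and Parseval's identity on grids of roots of unity\<close>

text \<open>Enumerating the roots as powers of a primitive one turns the sum into a geometric
  series.\<close>

lemma sum_roots_unity_orthogonal: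
  assumes "a < N" "b < N"
  shows "(\<Sum>z | z ^ N = 1. z ^ a * cnj (z ^ b)) = (if a = b then of_nat N else (0::complex))"
proof -
  have N: "N > 0" using assms by simp
  define \<omega> where "\<omega> = (\<lambda>k. cis (2 * pi * real k / real N))"
  have bij: "bij_betw \<omega> {..<N} {z. z ^ N = 1}"
    unfolding \<omega>_def by (rule Complex.bij_betw_roots_unity[OF N])
  \<comment> \<open>The ratio \<open>x\<close> is an \<open>N\<close>-th root of unity; since
    \<open>a\<close> and \<open>b\<close> lie below \<open>N\<close>, it equals 1 only for
    \<open>a = b\<close>.\<close>
  define x where "x = \<omega> a * cnj (\<omega> b)"
  have step: "\<omega> k ^ a * cnj (\<omega> k ^ b) = x ^ k" for k
    unfolding x_def \<omega>_def by (simp add: power_mult_distrib Complex.DeMoivre cis_cnj cis_mult algebra_simps)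
  have "(\<Sum>z | z ^ N = 1. z ^ a * cnj (z ^ b)) = (\<Sum>k<N. x ^ k)"
    by (simp only: sum.reindex_bij_betw[OF bij, symmetric] step)
  also have "\<dots> = (if a = b then of_nat N else 0)"
  proof (cases "a = b")
    case True
    have "x = 1" unfolding x_def \<omega>_def True by (simp add: cis_cnj cis_mult)
    then show ?thesis using True by simp
  next
    case False
    have mem: "\<omega> a ^ N = 1" "\<omega> b ^ N = 1" using bij assms by (auto simp: bij_betw_def)
    have "x \<noteq> 1"
    proof
      assume "x = 1"
      then have "\<omega> a * (cnj (\<omega> b) * \<omega> b) = \<omega> b" by (simp add: x_def mult.assoc[symmetric])
      then have "\<omega> a = \<omega> b" unfolding \<omega>_def by (simp add: cis_cnj cis_mult)
      then show False using bij assms False by (auto simp: bij_betw_def inj_on_def)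
    qed
    moreover have "x ^ N = 1" by (simp add: x_def power_mult_distrib mem flip: complex_cnj_power)
    ultimately show ?thesis using False by (simp add: sum_gp_strict)
  qed
  finally show ?thesis .
qed

text \<open>A finite substitute for the torus: for trigonometric polynomials with all frequencies
  below \<open>N\<close> in absolute value, the grid average equals the integral.\<close>

definition roots_grid :: "nat \<Rightarrow> nat \<Rightarrow> (nat \<Rightarrow> complex) set" where
  "roots_grid n N = {..<n} \<rightarrow>\<^sub>E {z. z ^ N = 1}"

lemma finite_roots_grid: "N > 0 \<Longrightarrow> finite (roots_grid n N)"
  unfolding roots_grid_def by (intro finite_PiE finite_lessThan finite_roots_unity) simp

lemma card_roots_grid: "N > 0 \<Longrightarrow> card (roots_grid n N) = N ^ n"
  by (simp add: roots_grid_def card_PiE card_roots_unity_eq)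

lemma norm_roots_grid:
  assumes "z \<in> roots_grid n N" "N > 0" "i < n"
  shows "cmod (z i) = 1"
proof -
  have "z i ^ N = 1" using assms by (auto simp: roots_grid_def PiE_iff)
  then show ?thesis using assms(2) power_eq_1_iff by blast
qed

lemma multi_indices_le: "\<alpha> \<in> multi_indices n m \<Longrightarrow> i < n \<Longrightarrow> \<alpha> i \<le> m"
  using member_le_sum[of i "{..<n}" \<alpha>] by (auto simp: multi_indices_def)

lemma multi_indices_eqI:
  assumes "\<alpha> \<in> multi_indices n m" "\<beta> \<in> multi_indices n k" "\<And>i. i < n \<Longrightarrow> \<alpha> i = \<beta> i"
  shows "\<alpha> = \<beta>"
  using assms by (intro extensionalityI[of _ "{..<n}"]) (auto simp: multi_indices_def PiE_iff)

text \<open>The sum over the product grid factors into one-dimensional sums. As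
  \<open>m < N\<close>, all exponents lie below \<open>N\<close>, so distinct indices are separated
  in some coordinate.\<close>

lemma sum_roots_grid_monomial_at:
  assumes "\<alpha> \<in> multi_indices n m" "\<beta> \<in> multi_indices n m" "m < N"
  shows "(\<Sum>z\<in>roots_grid n N. monomial_at n \<alpha> z * cnj (monomial_at n \<beta> z))
    = (if \<alpha> = \<beta> then of_nat (N ^ n) else 0)"
proof -
  have "(\<Sum>z\<in>roots_grid n N. monomial_at n \<alpha> z * cnj (monomial_at n \<beta> z))
      = (\<Sum>z\<in>roots_grid n N. \<Prod>i<n. z i ^ \<alpha> i * cnj (z i ^ \<beta> i))"
    by (simp add: monomial_at_def prod.distrib)
  also have "\<dots> = (\<Prod>i<n. \<Sum>w | w ^ N = 1. w ^ \<alpha> i * cnj (w ^ \<beta> i))"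
    unfolding roots_grid_def using assms(3)
    by (intro prod_sum_PiE[symmetric] finite_lessThan finite_roots_unity) simp
  also have "\<dots> = (\<Prod>i<n. if \<alpha> i = \<beta> i then of_nat N else 0)"
    using assms by (intro prod.cong refl sum_roots_unity_orthogonal)
      (auto intro: le_less_trans[OF multi_indices_le])
  also have "\<dots> = (if \<alpha> = \<beta> then of_nat (N ^ n) else 0)"
  proof (cases "\<alpha> = \<beta>")
    case False
    then obtain i where "i < n" "\<alpha> i \<noteq> \<beta> i" using multi_indices_eqI[OF assms(1,2)] by blast
    then have "(\<Prod>i<n. if \<alpha> i = \<beta> i then of_nat N else (0::complex)) = 0"
      by (intro prod_zero) auto
    then show ?thesis using False by simp
  qed simp
  finally show ?thesis .
qed

lemma parseval_roots_grid:
  assumes "m < N"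
  shows "(\<Sum>z\<in>roots_grid n N. (cmod (hom_poly n m a z))\<^sup>2)
    = real N ^ n * (\<Sum>\<alpha>\<in>multi_indices n m. (cmod (a \<alpha>))\<^sup>2)"
proof -
  let ?I = "multi_indices n m" and ?M = "monomial_at n"
  have "complex_of_real (\<Sum>z\<in>roots_grid n N. (cmod (hom_poly n m a z))\<^sup>2)
      = (\<Sum>z\<in>roots_grid n N. hom_poly n m a z * cnj (hom_poly n m a z))"
    by (simp add: complex_norm_square flip: of_real_power)
  also have "\<dots> = (\<Sum>z\<in>roots_grid n N. \<Sum>\<alpha>\<in>?I. \<Sum>\<beta>\<in>?I. a \<alpha> * cnj (a \<beta>) * (?M \<alpha> z * cnj (?M \<beta> z)))"
    by (simp add: hom_poly_def sum_product mult_ac)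
  also have "\<dots> = (\<Sum>\<alpha>\<in>?I. \<Sum>\<beta>\<in>?I. a \<alpha> * cnj (a \<beta>) * (\<Sum>z\<in>roots_grid n N. ?M \<alpha> z * cnj (?M \<beta> z)))"
    by (subst sum.swap, rule sum.cong[OF refl], subst sum.swap) (simp add: sum_distrib_left)
  also have "\<dots> = (\<Sum>\<alpha>\<in>?I. \<Sum>\<beta>\<in>?I. if \<alpha> = \<beta> then a \<alpha> * cnj (a \<beta>) * of_nat (N ^ n) else 0)"
    by (intro sum.cong refl) (simp add: sum_roots_grid_monomial_at[OF _ _ assms])
  also have "\<dots> = (\<Sum>\<alpha>\<in>?I. of_nat (N ^ n) * (a \<alpha> * cnj (a \<alpha>)))"
    by (intro sum.cong refl) (simp add: finite_multi_indices mult_ac)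
  also have "\<dots> = complex_of_real (real N ^ n * (\<Sum>\<alpha>\<in>?I. (cmod (a \<alpha>))\<^sup>2))"
    by (simp add: sum_distrib_left complex_norm_square del: of_real_power) (simp add: of_real_power)
  finally show ?thesis by (simp only: of_real_eq_iff)
qed

section \<open>Coefficients of products and the comparison of 2-norm and 1-norm\<close>

text \<open>The convolution giving the coefficients of a product of homogeneous polynomials.
  Restricting the sum of two indices to \<open>{..<n}\<close> keeps it extensional.\<close>

definition hom_coeff_mult ::
    "nat \<Rightarrow> nat \<Rightarrow> nat \<Rightarrow> ((nat \<Rightarrow> nat) \<Rightarrow> complex) \<Rightarrow> ((nat \<Rightarrow> nat) \<Rightarrow> complex)
      \<Rightarrow> (nat \<Rightarrow> nat) \<Rightarrow> complex" where
  "hom_coeff_mult n m k a b \<delta> =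
    (\<Sum>p\<in>{p \<in> multi_indices n m \<times> multi_indices n k. (\<lambda>i\<in>{..<n}. fst p i + snd p i) = \<delta>}.
      a (fst p) * b (snd p))"

lemma multi_indices_add:
  "\<beta> \<in> multi_indices n m \<Longrightarrow> \<gamma> \<in> multi_indices n k \<Longrightarrow>
    (\<lambda>i\<in>{..<n}. \<beta> i + \<gamma> i) \<in> multi_indices n (m + k)"
  by (auto simp: multi_indices_def sum.distrib)

lemma hom_poly_mult:
  "hom_poly n m a z * hom_poly n k b z = hom_poly n (m + k) (hom_coeff_mult n m k a b) z"
proof -
  let ?X = "multi_indices n m \<times> multi_indices n k"
  let ?g = "\<lambda>p. \<lambda>i\<in>{..<n}. fst p i + snd p i :: nat"
  have mon: "monomial_at n (?g p) z = monomial_at n (fst p) z * monomial_at n (snd p) z" for p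
    by (simp add: monomial_at_def power_add prod.distrib)
  have "hom_poly n m a z * hom_poly n k b z
      = (\<Sum>p\<in>?X. a (fst p) * b (snd p) * monomial_at n (?g p) z)"
    by (simp add: hom_poly_def sum_product sum.cartesian_product mon mult_ac case_prod_beta)
  also have "\<dots> = (\<Sum>\<delta>\<in>multi_indices n (m + k). \<Sum>p\<in>{p \<in> ?X. ?g p = \<delta>}.
      a (fst p) * b (snd p) * monomial_at n (?g p) z)"
    by (intro sum.group[symmetric] finite_multi_indices finite_cartesian_product)
      (auto intro: multi_indices_add)
  also have "\<dots> = hom_poly n (m + k) (hom_coeff_mult n m k a b) z"
    unfolding hom_poly_def hom_coeff_mult_def by (simp add: sum_distrib_right)
  finally show ?thesis .
qed

text \<open>The first summand determines the second and lies coordinatewise below \<delta>, which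
  leaves at most \<Prod>(\<delta> i + 1) \<le> \<Prod>2^(\<delta> i) choices.\<close>

lemma card_add_multi_indices_le:
  assumes "\<delta> \<in> multi_indices n (m + k)"
  shows "card {p \<in> multi_indices n m \<times> multi_indices n k. (\<lambda>i\<in>{..<n}. fst p i + snd p i) = \<delta>}
    \<le> 2 ^ (m + k)" (is "card ?P \<le> _")
proof -
  have add: "fst p i + snd p i = \<delta> i" if "p \<in> ?P" "i < n" for p i
    using that by force
  have "card ?P \<le> card (PiE {..<n} (\<lambda>i. {..\<delta> i}))"
  proof (rule card_inj_on_le)
    show "inj_on fst ?P"
    proof (rule inj_onI)
      fix p q assume pq: "p \<in> ?P" "q \<in> ?P" "fst p = fst q"
      have "snd p i = snd q i" if "i < n" for i
        using add[OF pq(1) that] add[OF pq(2) that] pq(3) by simp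
      moreover have "snd p \<in> multi_indices n k" "snd q \<in> multi_indices n k" using pq by auto
      ultimately show "p = q" using pq(3) multi_indices_eqI by (metis prod_eqI)
    qed
    show "fst ` ?P \<subseteq> (\<Pi>\<^sub>E i\<in>{..<n}. {..\<delta> i})"
    proof (rule image_subsetI)
      fix p assume p: "p \<in> ?P"
      have "fst p i \<le> \<delta> i" if "i < n" for i using add[OF p that] by simp
      moreover have "fst p \<in> extensional {..<n}" using p by (auto simp: multi_indices_def PiE_iff)
      ultimately show "fst p \<in> (\<Pi>\<^sub>E i\<in>{..<n}. {..\<delta> i})" by (auto simp: PiE_iff)
    qed
  qed (simp add: finite_PiE)
  also have "\<dots> = (\<Prod>i<n. Suc (\<delta> i))" by (simp add: card_PiE)
  also have "\<dots> \<le> (\<Prod>i<n. 2 ^ \<delta> i)" by (intro prod_mono conjI) (auto intro: Suc_leI)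
  also have "\<dots> = 2 ^ (m + k)" using assms by (simp add: multi_indices_def flip: power_sum)
  finally show ?thesis .
qed

text \<open>Cauchy-Schwarz on each fibre of the addition map costs the size of the fibre. The fibres
  partition all pairs, so the remaining double sum factors.\<close>

lemma sum_norm_hom_coeff_mult_le:
  "(\<Sum>\<delta>\<in>multi_indices n (m + k). (cmod (hom_coeff_mult n m k a b \<delta>))\<^sup>2)
    \<le> 2 ^ (m + k) * ((\<Sum>\<beta>\<in>multi_indices n m. (cmod (a \<beta>))\<^sup>2) * (\<Sum>\<gamma>\<in>multi_indices n k. (cmod (b \<gamma>))\<^sup>2))"
proof -
  let ?X = "multi_indices n m \<times> multi_indices n k"
  let ?g = "\<lambda>p. \<lambda>i\<in>{..<n}. fst p i + snd p i :: nat"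
  let ?f = "\<lambda>p. (cmod (a (fst p)))\<^sup>2 * (cmod (b (snd p)))\<^sup>2"
  have "(cmod (hom_coeff_mult n m k a b \<delta>))\<^sup>2 \<le> 2 ^ (m + k) * (\<Sum>p\<in>{p \<in> ?X. ?g p = \<delta>}. ?f p)"
    if \<delta>: "\<delta> \<in> multi_indices n (m + k)" for \<delta>
  proof -
    let ?P = "{p \<in> ?X. ?g p = \<delta>}"
    have "(cmod (hom_coeff_mult n m k a b \<delta>))\<^sup>2 \<le> (\<Sum>p\<in>?P. cmod (a (fst p) * b (snd p)))\<^sup>2"
      unfolding hom_coeff_mult_def by (intro power_mono norm_sum norm_ge_zero)
    also have "\<dots> \<le> (\<Sum>p\<in>?P. (cmod (a (fst p) * b (snd p)))\<^sup>2) * card ?P"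
      by (rule sum_squared_le_sum_of_squares)
    also have "\<dots> = card ?P * (\<Sum>p\<in>?P. ?f p)"
      by (simp add: norm_mult power_mult_distrib)
    also have "\<dots> \<le> 2 ^ (m + k) * (\<Sum>p\<in>?P. ?f p)"
    proof (intro mult_right_mono sum_nonneg)
      have "real (card ?P) \<le> real (2 ^ (m + k))"
        using card_add_multi_indices_le[OF \<delta>] by (intro of_nat_mono)
      then show "real (card ?P) \<le> 2 ^ (m + k)" by simp
    qed simp
    finally show ?thesis .
  qed
  then have "(\<Sum>\<delta>\<in>multi_indices n (m + k). (cmod (hom_coeff_mult n m k a b \<delta>))\<^sup>2)
      \<le> (\<Sum>\<delta>\<in>multi_indices n (m + k). 2 ^ (m + k) * (\<Sum>p\<in>{p \<in> ?X. ?g p = \<delta>}. ?f p))"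
    by (rule sum_mono)
  also have "\<dots> = 2 ^ (m + k) * (\<Sum>p\<in>?X. ?f p)"
    unfolding sum_distrib_left[symmetric]
    by (subst sum.group) (auto intro: multi_indices_add finite_multi_indices)
  finally show ?thesis by (simp add: sum_product sum.cartesian_product case_prod_beta)
qed

text \<open>The 4-norm is controlled by applying Parseval to the square, whose degree
  \<open>2 * m\<close> explains the bound on \<open>N\<close>. Interpolating the 2-norm between the
  1-norm and the 4-norm then gives the claim.\<close>

lemma hypercontractive_roots_grid:
  assumes "2 * m < N"
  shows "real N ^ n * sqrt (\<Sum>\<alpha>\<in>multi_indices n m. (cmod (a \<alpha>))\<^sup>2)
    \<le> 2 ^ m * (\<Sum>z\<in>roots_grid n N. cmod (hom_poly n m a z))"
proof -
  define X where "X = (\<Sum>\<alpha>\<in>multi_indices n m. (cmod (a \<alpha>))\<^sup>2)"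
  define q where "q z = cmod (hom_poly n m a z)" for z
  define K where "K = real N ^ n"
  \<comment> \<open>\<open>?E\<close> is an unnormalised sum over the grid, hence the factors
    \<open>K\<close>, the number of grid points.\<close>
  let ?E = "\<lambda>f. \<Sum>z\<in>roots_grid n N. (f z :: real)"
  have K: "K > 0" using assms by (simp add: K_def)
  have X0: "X \<ge> 0" by (simp add: X_def sum_nonneg)
  have q0: "q z \<ge> 0" for z by (simp add: q_def)
  have E2: "?E (\<lambda>z. q z ^ 2) = K * X"
    unfolding q_def X_def K_def using assms by (intro parseval_roots_grid) simp
  have "?E (\<lambda>z. q z ^ 4) = ?E (\<lambda>z. (cmod (hom_poly n (m + m) (hom_coeff_mult n m m a a) z))\<^sup>2)"
    by (simp add: q_def norm_mult power_mult_distrib flip: hom_poly_mult power_add)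
  also have "\<dots> = K * (\<Sum>\<delta>\<in>multi_indices n (m + m). (cmod (hom_coeff_mult n m m a a \<delta>))\<^sup>2)"
    unfolding K_def using assms by (intro parseval_roots_grid) simp
  also have "\<dots> \<le> K * (2 ^ (m + m) * (X * X))"
    unfolding X_def using K by (intro mult_left_mono sum_norm_hom_coeff_mult_le) simp
  finally have E4: "?E (\<lambda>z. q z ^ 4) \<le> K * 4 ^ m * X\<^sup>2"
    by (simp add: power2_eq_square power_add flip: power_mult_distrib)
  \<comment> \<open>The interpolation consists of two Cauchy-Schwarz steps: second moment against
    first and third, then third against second and fourth.\<close>
  have "(?E (\<lambda>z. sqrt (q z) * (sqrt (q z) * q z)))\<^sup>2
      \<le> ?E (\<lambda>z. (sqrt (q z))\<^sup>2) * ?E (\<lambda>z. (sqrt (q z) * q z)\<^sup>2)"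
    by (rule Cauchy_Schwarz_ineq_sum)
  then have CS1: "(K * X)\<^sup>2 \<le> ?E q * ?E (\<lambda>z. q z ^ 3)"
    unfolding E2[symmetric]
    by (simp add: q0 power_mult_distrib flip: mult.assoc) (simp add: power2_eq_square power3_eq_cube mult.assoc)
  have "(?E (\<lambda>z. q z * (q z)\<^sup>2))\<^sup>2 \<le> ?E (\<lambda>z. (q z)\<^sup>2) * ?E (\<lambda>z. ((q z)\<^sup>2)\<^sup>2)"
    by (rule Cauchy_Schwarz_ineq_sum)
  then have CS2: "(?E (\<lambda>z. q z ^ 3))\<^sup>2 \<le> K * X * ?E (\<lambda>z. q z ^ 4)"
    unfolding E2[symmetric] by (simp add: power3_eq_cube power2_eq_square mult.assoc power4_eq_xxxx)
  have "K * sqrt X \<le> 2 ^ m * ?E q"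
  proof (cases "X = 0")
    case True
    then show ?thesis by (simp add: sum_nonneg q0)
  next
    case False
    then have X: "X > 0" using X0 by simp
    \<comment> \<open>Squaring \<open>CS1\<close> and inserting \<open>CS2\<close> and
      \<open>E4\<close> leaves the common factor \<open>K\<^sup>2 * X ^ 3\<close>, which is
      cancelled because \<open>X > 0\<close>.\<close>
    have "(K * X) ^ 4 = ((K * X)\<^sup>2)\<^sup>2" by simp
    also have "\<dots> \<le> (?E q * ?E (\<lambda>z. q z ^ 3))\<^sup>2" by (intro power_mono CS1) simp
    also have "\<dots> = (?E q)\<^sup>2 * (?E (\<lambda>z. q z ^ 3))\<^sup>2" by (simp add: power_mult_distrib)
    also have "\<dots> \<le> (?E q)\<^sup>2 * (K * X * (K * 4 ^ m * X\<^sup>2))"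
      using K X by (intro mult_left_mono order_trans[OF CS2] E4) auto
    also have "\<dots> = (4 ^ m * (?E q)\<^sup>2) * (K\<^sup>2 * X ^ 3)"
      by (simp add: power2_eq_square power3_eq_cube mult_ac)
    finally have "(K\<^sup>2 * X) * (K\<^sup>2 * X ^ 3) \<le> (4 ^ m * (?E q)\<^sup>2) * (K\<^sup>2 * X ^ 3)"
      by (simp add: power2_eq_square power3_eq_cube power4_eq_xxxx mult_ac)
    then have "K\<^sup>2 * X \<le> 4 ^ m * (?E q)\<^sup>2"
      using K X by (subst (asm) mult_le_cancel_right_pos) auto
    moreover have "(4::real) ^ m = (2 ^ m)\<^sup>2" by (simp add: power2_eq_square flip: power_mult_distrib)
    ultimately have "(K * sqrt X)\<^sup>2 \<le> (2 ^ m * ?E q)\<^sup>2"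
      using X by (simp add: power_mult_distrib)
    then show ?thesis by (rule power2_le_imp_le) (simp add: sum_nonneg q0)
  qed
  then show ?thesis unfolding K_def X_def q_def .
qed

section \<open>Cauchy's estimate for the Euler derivatives\<close>

lemma hom_poly_cong:
  "(\<And>i. i < n \<Longrightarrow> z i = w i) \<Longrightarrow> hom_poly n m a z = hom_poly n m a w"
  by (simp add: hom_poly_def monomial_at_def)

lemma hom_poly_scale: "hom_poly n m a (\<lambda>i. c * z i) = c ^ m * hom_poly n m a z"
proof -
  have "monomial_at n \<alpha> (\<lambda>i. c * z i) = c ^ m * monomial_at n \<alpha> z" if "\<alpha> \<in> multi_indices n m" for \<alpha>
    using that by (simp add: monomial_at_def power_mult_distrib prod.distrib multi_indices_def flip: power_sum)
  then show ?thesis by (simp add: hom_poly_def sum_distrib_left mult_ac)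
qed

text \<open>Homogeneity carries the supremum over the polydisc to radius \<open>r\<close>, at the
  price of \<open>r ^ m\<close>. This is used for points pushed outside the unit polydisc by
  exponential factors.\<close>

lemma norm_hom_poly_le:
  assumes "r > 0" "\<And>i. i < n \<Longrightarrow> cmod (z i) < r"
  shows "cmod (hom_poly n m a z) \<le> r ^ m * (SUP z\<in>polydisc n. cmod (hom_poly n m a z))"
proof -
  define w where "w = (\<lambda>i\<in>{..<n}. z i / of_real r)"
  have "w \<in> polydisc n" using assms by (auto simp: w_def polydisc_def norm_divide)
  then have "cmod (hom_poly n m a w) \<le> (SUP z\<in>polydisc n. cmod (hom_poly n m a z))"
    by (intro cSUP_upper bdd_above_hom_poly)
  moreover have "hom_poly n m a z = of_real r ^ m * hom_poly n m a w"
    unfolding hom_poly_scale[symmetric] using assms(1) by (intro hom_poly_cong) (simp add: w_def)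
  ultimately show ?thesis using assms(1) by (simp add: norm_mult norm_power)
qed

lemma cnj_sgn_mult_self: "cnj (sgn z) * z = complex_of_real (cmod z)"
proof (cases "z = 0")
  case False
  have "cnj (sgn z) * z = (z * cnj z) / complex_of_real (cmod z)"
    by (simp add: sgn_eq mult_ac)
  then show ?thesis using False by (simp add: power2_eq_square flip: complex_norm_square)
qed simp

text \<open>
  With \<open>u\<^sub>j\<close> the conjugate sign of the \<open>j\<close>-th polynomial at \<open>z\<close>, the left-hand side is the derivative at
  \<open>t = 0\<close> of \<open>t \<mapsto> P (z\<^sub>1 exp (t u\<^sub>1), \<dots>, z\<^sub>n exp (t u\<^sub>n))\<close>, to which
  Cauchy's estimate on the unit circle applies.
\<close>

lemma sum_norm_euler_hom_poly_le:
  assumes z: "\<And>i. i < n \<Longrightarrow> cmod (z i) \<le> 1"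
  shows "(\<Sum>j<n. cmod (hom_poly n m (\<lambda>\<alpha>. of_nat (\<alpha> j) * a \<alpha>) z))
    \<le> 3 ^ m * (SUP z\<in>polydisc n. cmod (hom_poly n m a z))"
proof -
  define Q where "Q j = hom_poly n m (\<lambda>\<alpha>. of_nat (\<alpha> j) * a \<alpha>) z" for j
  define u where "u j = cnj (sgn (Q j))" for j
  \<comment> \<open>Along the curve, the monomial of index \<alpha> is multiplied by
    \<open>exp (t * s \<alpha>)\<close>.\<close>
  define s where "s \<alpha> = (\<Sum>j<n. of_nat (\<alpha> j) * u j)" for \<alpha> :: "nat \<Rightarrow> nat"
  define f where "f t = (\<Sum>\<alpha>\<in>multi_indices n m. a \<alpha> * monomial_at n \<alpha> z * exp (t * s \<alpha>))" for t
  have f: "f t = hom_poly n m a (\<lambda>i. z i * exp (t * u i))" for t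
  proof -
    have "exp (t * s \<alpha>) = (\<Prod>i<n. exp (t * u i) ^ \<alpha> i)" for \<alpha>
      by (simp add: s_def sum_distrib_left exp_sum mult_ac flip: exp_of_nat_mult)
    then show ?thesis
      by (simp add: f_def hom_poly_def monomial_at_def power_mult_distrib prod.distrib mult_ac)
  qed
  have "(\<Sum>\<alpha>\<in>multi_indices n m. a \<alpha> * monomial_at n \<alpha> z * s \<alpha>) = (\<Sum>j<n. u j * Q j)"
    unfolding s_def Q_def hom_poly_def sum_distrib_left
    by (subst sum.swap) (simp add: mult_ac)
  also have "\<dots> = complex_of_real (\<Sum>j<n. cmod (Q j))"
    by (simp add: u_def cnj_sgn_mult_self)
  finally have "(\<Sum>\<alpha>\<in>multi_indices n m. a \<alpha> * monomial_at n \<alpha> z * s \<alpha>)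
    = complex_of_real (\<Sum>j<n. cmod (Q j))" .
  moreover have "(f has_field_derivative (\<Sum>\<alpha>\<in>multi_indices n m. a \<alpha> * monomial_at n \<alpha> z * s \<alpha>)) (at 0)"
    unfolding f_def by (auto intro!: derivative_eq_intros sum.cong)
  ultimately have "(f has_field_derivative complex_of_real (\<Sum>j<n. cmod (Q j))) (at 0)"
    by simp
  then have deriv: "deriv f 0 = complex_of_real (\<Sum>j<n. cmod (Q j))"
    by (rule DERIV_imp_deriv)
  have hol: "f holomorphic_on UNIV" unfolding f_def by (intro holomorphic_intros)
  have "cmod ((deriv ^^ 1) f 0) \<le> fact 1 * (3 ^ m * (SUP z\<in>polydisc n. cmod (hom_poly n m a z))) / 1 ^ 1"
  proof (rule Cauchy_inequality)
    show "f holomorphic_on ball 0 1" "continuous_on (cball 0 1) f"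
      using hol by (auto intro: holomorphic_on_subset holomorphic_on_imp_continuous_on)
    fix t :: complex assume t: "cmod (0 - t) = 1"
    show "cmod (f t) \<le> 3 ^ m * (SUP z\<in>polydisc n. cmod (hom_poly n m a z))"
      unfolding f
    proof (rule norm_hom_poly_le)
      fix i assume i: "i < n"
      have "cmod (t * u i) \<le> 1" using t by (simp add: u_def norm_mult norm_sgn)
      then have "exp (Re (t * u i)) \<le> exp 1"
        using complex_Re_le_cmod[of "t * u i"] by simp
      \<comment> \<open>Origin of the constant 3: any number strictly above e serves, strictness
        being required because the polydisc is open.\<close>
      also have "exp 1 < (3::real)" using e_less_272 by simp
      finally have "cmod (exp (t * u i)) < 3" by simp
      moreover have "cmod (z i * exp (t * u i)) \<le> 1 * cmod (exp (t * u i))"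
        unfolding norm_mult by (intro mult_right_mono z[OF i] norm_ge_zero)
      ultimately show "cmod (z i * exp (t * u i)) < 3" by linarith
    qed simp
  qed simp
  then have "\<bar>\<Sum>j<n. cmod (Q j)\<bar> \<le> 3 ^ m * (SUP z\<in>polydisc n. cmod (hom_poly n m a z))"
    by (simp add: deriv flip: of_real_sum)
  then show ?thesis by (simp add: Q_def)
qed

section \<open>The weighted Hoelder inequality for the coefficients\<close>

text \<open>This is the multinomial theorem with its coefficients, all at least 1, dropped. The
  induction needs no coefficients: overcounting only enlarges a sum of nonnegative terms.\<close>

lemma sum_multi_indices_prod_le:
  fixes A :: "nat \<Rightarrow> real"
  assumes A: "\<And>i. i < n \<Longrightarrow> A i \<ge> 0"
  shows "(\<Sum>\<alpha>\<in>multi_indices n m. \<Prod>i<n. A i ^ \<alpha> i) \<le> (\<Sum>i<n. A i) ^ m"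
proof (induction m)
  case 0
  have "multi_indices n 0 \<subseteq> {\<lambda>i\<in>{..<n}. 0}"
    by (auto simp: multi_indices_def PiE_iff extensional_def)
  then have "(\<Sum>\<alpha>\<in>multi_indices n 0. \<Prod>i<n. A i ^ \<alpha> i)
      \<le> (\<Sum>\<alpha>\<in>{\<lambda>i\<in>{..<n}. 0::nat}. \<Prod>i<n. A i ^ \<alpha> i)"
    using A by (intro sum_mono2) (auto intro!: prod_nonneg)
  then show ?case by simp
next
  case (Suc m)
  let ?g = "\<lambda>\<alpha>. \<Prod>i<n. A i ^ \<alpha> i"
  let ?inc = "\<lambda>(j, \<beta>). \<beta>(j := Suc (\<beta> j))"
  let ?X = "{..<n} \<times> multi_indices n m"
  \<comment> \<open>Lowering a nonzero coordinate exhibits each index of order \<open>Suc m\<close>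
    as an increment of one of order \<open>m\<close>.\<close>
  have "multi_indices n (Suc m) \<subseteq> ?inc ` ?X"
  proof
    fix \<alpha> assume \<alpha>: "\<alpha> \<in> multi_indices n (Suc m)"
    then have "(\<Sum>i<n. \<alpha> i) \<noteq> 0" by (simp add: multi_indices_def)
    then obtain j where j: "j < n" "\<alpha> j \<noteq> 0" by auto
    let ?\<beta> = "\<alpha>(j := \<alpha> j - 1)"
    have "(\<Sum>i<n. \<alpha> i) = \<alpha> j + (\<Sum>i\<in>{..<n} - {j}. \<alpha> i)"
      using j by (intro sum.remove) auto
    moreover have "(\<Sum>i<n. ?\<beta> i) = ?\<beta> j + (\<Sum>i\<in>{..<n} - {j}. ?\<beta> i)"
      using j by (intro sum.remove) auto
    ultimately have "?\<beta> \<in> multi_indices n m"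
      using j \<alpha> by (auto simp: multi_indices_def PiE_iff extensional_def)
    moreover have "\<alpha> = ?inc (j, ?\<beta>)" using j by auto
    ultimately show "\<alpha> \<in> ?inc ` ?X" using j by blast
  qed
  then have "sum ?g (multi_indices n (Suc m)) \<le> sum ?g (?inc ` ?X)"
    using A by (intro sum_mono2) (auto intro!: prod_nonneg simp: finite_multi_indices)
  also have "\<dots> \<le> sum (?g \<circ> ?inc) ?X"
    using A by (intro sum_image_le) (auto intro!: prod_nonneg simp: finite_multi_indices)
  also have "\<dots> = (\<Sum>(j, \<beta>)\<in>?X. A j * ?g \<beta>)"
  proof (rule sum.cong[OF refl])
    fix p assume "p \<in> ?X"
    then obtain j \<beta> where p: "p = (j, \<beta>)" and j: "j \<in> {..<n}" by auto
    show "(?g \<circ> ?inc) p = (case p of (j, \<beta>) \<Rightarrow> A j * ?g \<beta>)"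
      unfolding p using j by (simp add: prod.remove[of "{..<n}" j] mult.assoc)
  qed
  also have "\<dots> = (\<Sum>i<n. A i) * sum ?g (multi_indices n m)"
    by (simp add: sum_product sum.cartesian_product)
  also have "\<dots> \<le> (\<Sum>i<n. A i) * (\<Sum>i<n. A i) ^ m"
    using A by (intro mult_left_mono Suc.IH sum_nonneg) auto
  finally show ?case by simp
qed

text \<open>The termwise Young inequality behind Hoelder's, with exponents (m+1)/m and m+1; the
  weight w(\<alpha>) is \<open>exp (L / m)\<close> in the proof.\<close>

lemma weighted_young:
  fixes A :: "'i \<Rightarrow> real" and \<alpha> :: "'i \<Rightarrow> nat"
  assumes I: "finite I" "I \<noteq> {}" and m: "m \<ge> 1" "(\<Sum>j\<in>I. \<alpha> j) = m"
    and A: "\<And>j. j \<in> I \<Longrightarrow> \<alpha> j > 0 \<Longrightarrow> A j > 0" and "x > 0" "S > 0"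
  shows "x powr (2 * real m / (real m + 1)) \<le> S powr (2 * real m / (real m + 1)) *
    (real m / (real m + 1) * (x\<^sup>2 / S * (\<Sum>j\<in>I. real (\<alpha> j) / real m / A j))
      + 1 / (real m + 1) * ((\<Prod>j\<in>I. A j ^ \<alpha> j) / S ^ m))"
proof -
  define L where "L = (\<Sum>j\<in>I. real (\<alpha> j) * ln (A j))"
  define \<theta> where "\<theta> = real m / (real m + 1)"
  have \<theta>: "0 \<le> \<theta>" "0 \<le> 1 - \<theta>" "1 / (real m + 1) = 1 - \<theta>"
    by (simp_all add: \<theta>_def divide_simps)
  have "(\<Sum>j\<in>I. real (\<alpha> j) / real m) = 1"
    using m by (simp flip: sum_divide_distrib of_nat_sum)
  \<comment> \<open>Weighted AM-GM, as Jensen's inequality for \<open>exp\<close> at the points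
    \<open>- ln (A j)\<close>.\<close>
  then have "exp (\<Sum>j\<in>I. (real (\<alpha> j) / real m) *\<^sub>R - ln (A j))
      \<le> (\<Sum>j\<in>I. real (\<alpha> j) / real m * exp (- ln (A j)))"
    by (intro convex_on_sum[OF I exp_convex]) auto
  \<comment> \<open>Where \<open>\<alpha> j = 0\<close> both terms vanish, so a value of
    \<open>ln\<close> or a quotient at \<open>A j = 0\<close> does no harm.\<close>
  also have "\<dots> = (\<Sum>j\<in>I. real (\<alpha> j) / real m / A j)"
  proof (intro sum.cong refl)
    fix j assume "j \<in> I"
    then show "real (\<alpha> j) / real m * exp (- ln (A j)) = real (\<alpha> j) / real m / A j"
      using A[of j] by (cases "\<alpha> j = 0") (auto simp: exp_minus field_simps)
  qed
  also have "(\<Sum>j\<in>I. (real (\<alpha> j) / real m) *\<^sub>R - ln (A j)) = - L / m"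
    by (simp add: L_def sum_negf sum_divide_distrib)
  finally have L1: "exp (- L / m) \<le> (\<Sum>j\<in>I. real (\<alpha> j) / real m / A j)" .
  have L2: "exp L = (\<Prod>j\<in>I. A j ^ \<alpha> j)"
    unfolding L_def exp_sum[OF I(1)]
  proof (intro prod.cong refl)
    fix j assume "j \<in> I"
    then show "exp (real (\<alpha> j) * ln (A j)) = A j ^ \<alpha> j"
      using A[of j] by (cases "\<alpha> j = 0") (auto simp: exp_of_nat_mult)
  qed
  \<comment> \<open>Chosen so that \<open>L\<close> cancels in
    \<open>\<theta> * v + (1 - \<theta>) * w\<close>, leaving the logarithm of (x/S)^p with p =
    2m/(m+1); convexity of \<open>exp\<close> then separates the two terms.\<close>
  define v where "v = 2 * ln x - ln S - L / m"
  define w where "w = L - m * ln S"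
  have ev: "exp v = x\<^sup>2 / S * exp (- L / m)"
    using assms by (simp add: v_def exp_diff exp_minus exp_double divide_inverse)
  have ew: "exp w = exp L / S ^ m"
    using assms by (simp add: w_def exp_diff exp_of_nat_mult)
  have "2 * real m / (real m + 1) * ln x = 2 * real m / (real m + 1) * ln S + (\<theta> * v + (1 - \<theta>) * w)"
  proof -
    have "\<theta> * v + (1 - \<theta>) * w = (real m * v + w) / (real m + 1)"
      unfolding \<theta>(3)[symmetric] by (simp add: \<theta>_def add_divide_distrib)
    moreover have "real m * v + w = 2 * real m * ln x - 2 * real m * ln S"
      using m(1) by (simp add: v_def w_def field_simps)
    ultimately show ?thesis by (simp add: diff_divide_distrib)
  qed
  then have "x powr (2 * real m / (real m + 1))
      = S powr (2 * real m / (real m + 1)) * exp (\<theta> * v + (1 - \<theta>) * w)"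
    using assms by (simp add: powr_def exp_add)
  also have "exp (\<theta> * v + (1 - \<theta>) * w) \<le> \<theta> * exp v + (1 - \<theta>) * exp w"
    using convex_onD[OF exp_convex, of "1 - \<theta>" v w] \<theta> by simp
  also have "\<dots> \<le> \<theta> * (x\<^sup>2 / S * (\<Sum>j\<in>I. real (\<alpha> j) / real m / A j))
      + (1 - \<theta>) * ((\<Prod>j\<in>I. A j ^ \<alpha> j) / S ^ m)"
    unfolding ev ew L2 using \<theta> assms by (intro add_right_mono mult_left_mono L1) auto
  finally show ?thesis using \<theta> by (simp add: \<theta>_def mult_left_mono)
qed

text \<open>After normalisation by \<open>S\<close>, each of the two terms of Young's inequality
  sums to at most 1 over all indices, and their weights \<theta> and 1 - \<theta> add up to
  1.\<close>

lemma sum_norm_coeffs_le: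
  fixes n :: nat and a :: "(nat \<Rightarrow> nat) \<Rightarrow> complex"
  assumes m: "m \<ge> 1"
  defines "p \<equiv> 2 * real m / (real m + 1)"
  defines "A \<equiv> \<lambda>j. sqrt (\<Sum>\<alpha>\<in>multi_indices n m. (cmod (of_nat (\<alpha> j) * a \<alpha>))\<^sup>2)"
  shows "(\<Sum>\<alpha>\<in>multi_indices n m. cmod (a \<alpha>) powr p) \<le> (\<Sum>j<n. A j) powr p"
proof -
  let ?I = "multi_indices n m"
  define S where "S = (\<Sum>j<n. A j)"
  define \<theta> where "\<theta> = real m / (real m + 1)"
  have \<theta>: "0 \<le> \<theta>" "0 \<le> 1 - \<theta>" "1 / (real m + 1) = 1 - \<theta>"
    by (simp_all add: \<theta>_def divide_simps)
  have A0: "A j \<ge> 0" for j by (simp add: A_def sum_nonneg)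
  then have S0: "S \<ge> 0" by (simp add: S_def sum_nonneg)
  have A_pos: "A j > 0" if "\<alpha> \<in> ?I" "a \<alpha> \<noteq> 0" "\<alpha> j > 0" for \<alpha> j
    unfolding A_def real_sqrt_gt_0_iff using that
    by (intro sum_pos2[OF finite_multi_indices that(1)]) auto
  have ex: "\<exists>j<n. \<alpha> j > 0" if "\<alpha> \<in> ?I" for \<alpha>
  proof -
    have "(\<Sum>i<n. \<alpha> i) \<noteq> 0" using that m by (simp add: multi_indices_def)
    then show ?thesis by auto
  qed
  show ?thesis
  proof (cases "S = 0")
    case True
    \<comment> \<open>As \<open>m \<ge> 1\<close>, each index has a positive coordinate
      \<open>j\<close>, and \<open>A j = 0\<close> then forces the coefficient to vanish.\<close>
    have "a \<alpha> = 0" if \<alpha>: "\<alpha> \<in> ?I" for \<alpha>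
    proof (rule ccontr)
      assume "a \<alpha> \<noteq> 0"
      obtain j where j: "j < n" "\<alpha> j > 0" using ex[OF \<alpha>] by blast
      have "A j = 0" using True A0 j(1) by (simp add: S_def sum_nonneg_eq_0_iff)
      then show False using A_pos[OF \<alpha> \<open>a \<alpha> \<noteq> 0\<close> j(2)] by simp
    qed
    then show ?thesis by simp
  next
    case False
    then have S: "S > 0" using S0 by simp
    let ?u = "\<lambda>\<alpha>. (cmod (a \<alpha>))\<^sup>2 / S * (\<Sum>j<n. real (\<alpha> j) / real m / A j)"
    let ?v = "\<lambda>\<alpha>. (\<Prod>j<n. A j ^ \<alpha> j) / S ^ m"
    have u0: "?u \<alpha> \<ge> 0" and v0: "?v \<alpha> \<ge> 0" for \<alpha> :: "nat \<Rightarrow> nat"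
      using S A0 by (auto intro!: mult_nonneg_nonneg sum_nonneg divide_nonneg_nonneg prod_nonneg)
    have "cmod (a \<alpha>) powr p \<le> S powr p * (\<theta> * ?u \<alpha> + (1 - \<theta>) * ?v \<alpha>)" if \<alpha>: "\<alpha> \<in> ?I" for \<alpha>
    proof (cases "a \<alpha> = 0")
      case True
      \<comment> \<open>A zero coefficient does not guarantee \<open>A j > 0\<close> on the support
        of \<alpha>, so nonnegativity replaces Young's inequality.\<close>
      have "0 \<le> S powr p * (\<theta> * ?u \<alpha> + (1 - \<theta>) * ?v \<alpha>)"
        by (intro mult_nonneg_nonneg[OF powr_ge_zero] add_nonneg_nonneg
            mult_nonneg_nonneg[OF \<theta>(1) u0] mult_nonneg_nonneg[OF \<theta>(2) v0])
      then show ?thesis using True by simp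
    next
      case False
      then show ?thesis
        unfolding p_def \<theta>_def \<theta>(3)[unfolded \<theta>_def, symmetric]
        using ex[OF \<alpha>] \<alpha> m S A_pos[OF \<alpha>]
        by (intro weighted_young) (auto simp: multi_indices_def)
    qed
    then have "(\<Sum>\<alpha>\<in>?I. cmod (a \<alpha>) powr p) \<le> (\<Sum>\<alpha>\<in>?I. S powr p * (\<theta> * ?u \<alpha> + (1 - \<theta>) * ?v \<alpha>))"
      by (rule sum_mono)
    also have "\<dots> = S powr p * (\<theta> * (\<Sum>\<alpha>\<in>?I. ?u \<alpha>) + (1 - \<theta>) * (\<Sum>\<alpha>\<in>?I. ?v \<alpha>))"
      by (simp only: sum.distrib flip: sum_distrib_left)
    also have "\<dots> \<le> S powr p * (\<theta> * 1 + (1 - \<theta>) * 1)"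
    proof (intro mult_left_mono add_mono)
      have "(\<Sum>\<alpha>\<in>?I. ?u \<alpha>) = (\<Sum>j<n. \<Sum>\<alpha>\<in>?I. real (\<alpha> j) / real m * (cmod (a \<alpha>))\<^sup>2 / A j) / S"
        by (subst sum.swap) (simp add: sum_distrib_left sum_divide_distrib mult_ac)
      also have "\<dots> \<le> (\<Sum>j<n. \<Sum>\<alpha>\<in>?I. (cmod (of_nat (\<alpha> j) * a \<alpha>))\<^sup>2 / A j) / S"
      proof (intro divide_right_mono sum_mono)
        fix j :: nat and \<alpha> :: "nat \<Rightarrow> nat"
        have "real (\<alpha> j) / real m \<le> real (\<alpha> j) / 1" using m by (intro divide_left_mono) auto
        also have "\<dots> \<le> (real (\<alpha> j))\<^sup>2" by (cases "\<alpha> j") (auto simp: power2_eq_square)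
        finally show "real (\<alpha> j) / real m * (cmod (a \<alpha>))\<^sup>2 \<le> (cmod (of_nat (\<alpha> j) * a \<alpha>))\<^sup>2"
          unfolding norm_mult power_mult_distrib norm_of_nat by (rule mult_right_mono) simp
      qed (use A0 S in auto)
      also have "(\<Sum>j<n. \<Sum>\<alpha>\<in>?I. (cmod (of_nat (\<alpha> j) * a \<alpha>))\<^sup>2 / A j) = (\<Sum>j<n. (A j)\<^sup>2 / A j)"
        by (simp add: A_def sum_nonneg flip: sum_divide_distrib)
      \<comment> \<open>\<open>(A j)\<^sup>2 / A j = A j\<close> also holds for
        \<open>A j = 0\<close>, by \<open>x / 0 = 0\<close>.\<close>
      also have "\<dots> / S = 1"
        using S by (simp add: power2_eq_square) (simp add: S_def)
      finally show "(\<Sum>\<alpha>\<in>?I. ?u \<alpha>) \<le> 1" .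
      have "(\<Sum>\<alpha>\<in>?I. ?v \<alpha>) \<le> S ^ m / S ^ m"
        unfolding sum_divide_distrib[symmetric] using sum_multi_indices_prod_le[of n A m] A0 S
        by (intro divide_right_mono) (auto simp: S_def)
      then show "(\<Sum>\<alpha>\<in>?I. ?v \<alpha>) \<le> 1" using S by simp
    qed (use \<theta> in auto)
    finally show ?thesis by (simp add: S_def)
  qed
qed

section \<open>Averaging over the grid and conclusion\<close>

text \<open>Each 2-norm is replaced by \<open>2 ^ m\<close> times a grid average of absolute values.
  Since the pointwise Cauchy bound controls the whole sum over \<open>j\<close> at once, no factor
  depending on \<open>n\<close> appears.\<close>

lemma sum_norm2_euler_coeffs_le:
  "(\<Sum>j<n. sqrt (\<Sum>\<alpha>\<in>multi_indices n m. (cmod (of_nat (\<alpha> j) * a \<alpha>))\<^sup>2))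
    \<le> 6 ^ m * (SUP z\<in>polydisc n. cmod (hom_poly n m a z))"
proof -
  let ?A = "\<lambda>j. sqrt (\<Sum>\<alpha>\<in>multi_indices n m. (cmod (of_nat (\<alpha> j) * a \<alpha>))\<^sup>2)"
  let ?Q = "\<lambda>j. hom_poly n m (\<lambda>\<alpha>. of_nat (\<alpha> j) * a \<alpha>)"
  let ?B = "SUP z\<in>polydisc n. cmod (hom_poly n m a z)"
  define N where "N = 2 * m + 1"
  let ?G = "roots_grid n N"
  have N: "N > 0" "2 * m < N" by (simp_all add: N_def)
  have "real N ^ n * (\<Sum>j<n. ?A j) \<le> (\<Sum>j<n. 2 ^ m * (\<Sum>z\<in>?G. cmod (?Q j z)))"
    unfolding sum_distrib_left[of "real N ^ n"] by (intro sum_mono hypercontractive_roots_grid N)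
  also have "\<dots> = 2 ^ m * (\<Sum>z\<in>?G. \<Sum>j<n. cmod (?Q j z))"
    by (subst sum.swap) (simp add: sum_distrib_left)
  also have "\<dots> \<le> 2 ^ m * (\<Sum>z\<in>?G. 3 ^ m * ?B)"
    using N by (intro mult_left_mono sum_mono sum_norm_euler_hom_poly_le) (auto simp: norm_roots_grid)
  also have "\<dots> = real N ^ n * ((2 ^ m * 3 ^ m) * ?B)"
    by (simp add: card_roots_grid N)
  also have "(2 ^ m * 3 ^ m :: real) = 6 ^ m"
    by (simp flip: power_mult_distrib)
  finally show ?thesis using N by simp
qed

theorem theorem1p1:
  shows "\<exists>C::real. C \<ge> 1 \<and>
     (\<forall>m n :: nat. m \<ge> 1 \<longrightarrow> n \<ge> 1 \<longrightarrow>
       (\<forall>a :: (nat \<Rightarrow> nat) \<Rightarrow> complex.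
          (\<Sum>\<alpha>\<in>multi_indices n m. cmod (a \<alpha>) powr (2 * real m / (real m + 1)))
              powr ((real m + 1) / (2 * real m))
            \<le> C ^ m * (SUP z\<in>polydisc n. cmod (hom_poly n m a z))))"
\<comment> \<open>6 = 2 * 3: the norm comparison gives \<open>2 ^ m\<close>, Cauchy's estimate
  \<open>3 ^ m\<close>.\<close>
proof (intro exI[of _ 6] conjI allI impI)
  fix m n :: nat and a :: "(nat \<Rightarrow> nat) \<Rightarrow> complex"
  assume m: "m \<ge> 1"
  let ?p = "2 * real m / (real m + 1)" and ?q = "(real m + 1) / (2 * real m)"
  let ?S = "\<Sum>j<n. sqrt (\<Sum>\<alpha>\<in>multi_indices n m. (cmod (of_nat (\<alpha> j) * a \<alpha>))\<^sup>2)"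
  have "(\<Sum>\<alpha>\<in>multi_indices n m. cmod (a \<alpha>) powr ?p) powr ?q \<le> (?S powr ?p) powr ?q"
    by (intro powr_mono2 sum_norm_coeffs_le m) (auto intro: sum_nonneg)
  \<comment> \<open>The exponents are reciprocal because \<open>m \<ge> 1\<close>, and
    \<open>?S\<close> is nonnegative.\<close>
  also have "\<dots> = ?S"
    using m by (simp add: powr_powr sum_nonneg)
  also have "\<dots> \<le> 6 ^ m * (SUP z\<in>polydisc n. cmod (hom_poly n m a z))"
    by (rule sum_norm2_euler_coeffs_le)
  finally show "(\<Sum>\<alpha>\<in>multi_indices n m. cmod (a \<alpha>) powr ?p) powr ?q
    \<le> 6 ^ m * (SUP z\<in>polydisc n. cmod (hom_poly n m a z))" .
qed simp

end
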